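(* Let $p,q,r>0$ and let $(Y_1,Y_2,Y_3)$ be a random vector with distribution $B_I(p+r,q+r)\otimes B_I(p,q+r)\otimes B_I(r,q)$ (i.e. $Y_1,Y_2,Y_3$ are independent with the indicated univariate beta distributions). Then $$\left(Y_2+(1-Y_1)(1-Y_2)Y_3,\ \frac{Y_1Y_2}{Y_2+(1-Y_1)(1-Y_2)Y_3},\ \frac{Y_1Y_3}{[1-(1-Y_1)Y_3]\,[Y_2+Y_3(1-Y_2)]}\right)\stackrel{d}{=}(Y_1,Y_2,Y_3),$$ where $\stackrel{d}{=}$ denotes equality in distribution of random vectors.
   Context: For $a,b>0$, $B_I(a,b)$ denotes the (first kind) beta distribution on $(0,1)$ with density $x^{a-1}(1-x)^{b-1}/B(a,b)$, where $B(a,b)=\Gamma(a)\Gamma(b)/\Gamma(a+b)$ is the Euler beta function. The symbol $\otimes$ denotes product measure. *)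

theory Defs
  imports "HOL-Probability.Probability"
begin

definition beta_density :: "real \<Rightarrow> real \<Rightarrow> real \<Rightarrow> real" where
  "beta_density a b x =
     (if 0 < x \<and> x < 1 then x powr (a - 1) * (1 - x) powr (b - 1) / Beta a b else 0)"

(* The law B_I(a,b), as a measure on all of the real line that is concentrated on (0,1). *)
definition beta_distribution :: "real \<Rightarrow> real \<Rightarrow> real measure" where
  "beta_distribution a b = density lborel (\<lambda>x. ennreal (beta_density a b x))"

end

theory Submission
  imports Defs
begin

text \<open>
  Write $T$ for the map in question, $e = 1 - (1 - y_1) y_3$ and $g = y_2 + y_3 (1 - y_2)$.
  On the open unit cube
  $1 - T_1 = (1 - y_2) e$, $T_1 (1 - T_2) = (1 - y_1) g$ and $1 - T_3 = (1 - y_3) T_1 / (e g)$,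
  so $T$ is an involution of the cube, and the powers of $T_1$ in the density $f$
  cancel: $f(T y) \cdot y_1 / (e g) = f(y)$.
  It remains to see that $y_1 / (e g)$ is the Jacobian.  This needs only one-dimensional affine
  substitutions, exchanging one coordinate at a time: $T_1$ is affine in $y_3$; then
  $y_2 = T_1 T_2 / y_1$ is linear in $T_2$; and, because $T$ is an involution,
  $y_1 = T_2 + (1 - T_1) (1 - T_2) T_3$ is affine in $T_3$.
\<close>

section \<open>The map on the open cube: factorizations, bounds, involution\<close>

definition cube :: "(real \<times> real \<times> real) set" where
  "cube = {0<..<1} \<times> {0<..<1} \<times> {0<..<1}"

definition E :: "real \<Rightarrow> real \<Rightarrow> real" where
  "E x z = 1 - (1 - x) * z"

text \<open>Equal to \<open>1 - (1 - y) * (1 - z)\<close>, the symmetric form on which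
  \<open>G_T\<close> rests.\<close>

definition G :: "real \<Rightarrow> real \<Rightarrow> real" where
  "G y z = y + z * (1 - y)"

definition T1 :: "real \<Rightarrow> real \<Rightarrow> real \<Rightarrow> real" where
  "T1 x y z = y + (1 - x) * (1 - y) * z"

definition T2 :: "real \<Rightarrow> real \<Rightarrow> real \<Rightarrow> real" where
  "T2 x y z = x * y / T1 x y z"

definition T3 :: "real \<Rightarrow> real \<Rightarrow> real \<Rightarrow> real" where
  "T3 x y z = x * z / (E x z * G y z)"

definition T :: "real \<times> real \<times> real \<Rightarrow> real \<times> real \<times> real" where
  "T = (\<lambda>(x, y, z). (T1 x y z, T2 x y z, T3 x y z))"

lemma mem_cube: "(x, y, z) \<in> cube \<longleftrightarrow> 0 < x \<and> x < 1 \<and> 0 < y \<and> y < 1 \<and> 0 < z \<and> z < 1"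
  by (auto simp: cube_def)

lemma measurable_T [measurable]:
  "T \<in> borel \<Otimes>\<^sub>M borel \<Otimes>\<^sub>M borel \<rightarrow>\<^sub>M borel \<Otimes>\<^sub>M borel \<Otimes>\<^sub>M borel"
  unfolding T_def T1_def T2_def T3_def E_def G_def by measurable

context
  fixes x y z :: real
  assumes xyz: "0 < x" "x < 1" "0 < y" "y < 1" "0 < z" "z < 1"
begin

lemma E_pos: "E x z > 0"
proof -
  have "(1 - x) * z < 1 * 1"
    using xyz by (intro mult_strict_mono) auto
  then show ?thesis by (simp add: E_def)
qed

lemma G_pos: "G y z > 0"
  using xyz by (simp add: G_def add_pos_pos)

lemma T1_pos: "T1 x y z > 0"
  using xyz by (simp add: T1_def add_pos_pos)

lemma T2_pos: "T2 x y z > 0"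
  using xyz T1_pos by (simp add: T2_def)

lemma T3_pos: "T3 x y z > 0"
  using xyz E_pos G_pos by (simp add: T3_def)

text \<open>With the next two lemmas, this writes the complements as products of positive factors:
  the upper bounds on the components follow, and the density at the image point becomes a product of
  powers.\<close>

lemma one_minus_T1: "1 - T1 x y z = (1 - y) * E x z"
  by (simp add: T1_def E_def algebra_simps)

lemma one_minus_T2: "1 - T2 x y z = (1 - x) * G y z / T1 x y z"
proof -
  have "T1 x y z - x * y = (1 - x) * G y z"
    by (simp add: T1_def G_def algebra_simps)
  then show ?thesis using T1_pos by (simp add: T2_def field_simps)
qed

lemma one_minus_T3: "1 - T3 x y z = (1 - z) * T1 x y z / (E x z * G y z)"
proof -
  have "E x z * G y z - x * z = (1 - z) * T1 x y z"
    by (simp add: T1_def G_def E_def algebra_simps)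
  then show ?thesis using E_pos G_pos by (simp add: T3_def field_simps)
qed

lemma T_less_1: "T1 x y z < 1" "T2 x y z < 1" "T3 x y z < 1"
proof -
  have "1 - T1 x y z > 0" "1 - T2 x y z > 0" "1 - T3 x y z > 0"
    unfolding one_minus_T1 one_minus_T2 one_minus_T3
    using xyz E_pos G_pos T1_pos by simp_all
  then show "T1 x y z < 1" "T2 x y z < 1" "T3 x y z < 1" by simp_all
qed

text \<open>In factored form \<open>E x z\<close> and \<open>G y z\<close> cancel, and the remaining
  numerator is \<open>x * y + (1 - y) * (1 - x) * x * z\<close>, which is
  \<open>x * T1 x y z\<close>.\<close>

lemma T1_T: "T1 (T1 x y z) (T2 x y z) (T3 x y z) = x"
proof -
  have "T1 (T1 x y z) (T2 x y z) (T3 x y z)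
      = x * y / T1 x y z + (1 - y) * E x z * ((1 - x) * G y z / T1 x y z) *
          (x * z / (E x z * G y z))"
    unfolding T1_def[of "T1 x y z"] one_minus_T1 one_minus_T2 by (simp add: T2_def T3_def)
  also have "\<dots> = x * T1 x y z / T1 x y z"
    using E_pos G_pos T1_pos by (simp add: field_simps) (simp add: T1_def algebra_simps)
  finally show ?thesis using T1_pos by simp
qed

text \<open>By \<open>T1_T\<close> the denominator at the image point is \<open>x\<close>, while the
  product of the first two components is \<open>x * y\<close>.\<close>

lemma T2_T: "T2 (T1 x y z) (T2 x y z) (T3 x y z) = y"
  using xyz T1_pos unfolding T2_def[of "T1 x y z"] T1_T by (simp add: T2_def)

text \<open>With \<open>G_T\<close>, this evaluates the denominator in \<open>T3_T\<close>: it
  becomes \<open>T1 x y z * x / (E x z * G y z)\<close>, so everything but \<open>z\<close>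
  cancels.\<close>

lemma E_T: "E (T1 x y z) (T3 x y z) = T1 x y z / G y z"
proof -
  have "E (T1 x y z) (T3 x y z) = 1 - (1 - y) * x * z / G y z"
    unfolding E_def[of "T1 x y z"] one_minus_T1 using E_pos by (simp add: T3_def)
  also have "\<dots> = T1 x y z / G y z"
    using G_pos by (simp add: field_simps) (simp add: G_def T1_def algebra_simps)
  finally show ?thesis .
qed

lemma G_T: "G (T2 x y z) (T3 x y z) = x / E x z"
proof -
  have "G (T2 x y z) (T3 x y z) = 1 - (1 - T2 x y z) * (1 - T3 x y z)"
    by (simp add: G_def algebra_simps)
  also have "\<dots> = 1 - (1 - x) * (1 - z) / E x z"
    unfolding one_minus_T2 one_minus_T3 using T1_pos G_pos by simp
  also have "\<dots> = x / E x z"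
    using E_pos by (simp add: field_simps) (simp add: E_def algebra_simps)
  finally show ?thesis .
qed

lemma T3_T: "T3 (T1 x y z) (T2 x y z) (T3 x y z) = z"
  using xyz T1_pos E_pos G_pos unfolding T3_def[of "T1 x y z"] E_T G_T
  by (simp add: T3_def)

end

lemma T_in_cube: "s \<in> cube \<Longrightarrow> T s \<in> cube"
  by (cases s) (auto simp: T_def mem_cube T1_pos T2_pos T3_pos T_less_1)

lemma T_involution: "s \<in> cube \<Longrightarrow> T (T s) = s"
  by (cases s) (auto simp: T_def mem_cube T1_T T2_T T3_T)

section \<open>Change of variables under the map\<close>

definition J :: "real \<times> real \<times> real \<Rightarrow> real" where
  "J = (\<lambda>(x, y, z). x / (E x z * G y z))"

lemma nn_integral_lborel_triple:
  fixes h :: "real \<times> real \<times> real \<Rightarrow> ennreal"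
  assumes [measurable]: "h \<in> borel_measurable (borel \<Otimes>\<^sub>M borel \<Otimes>\<^sub>M borel)"
  shows "(\<integral>\<^sup>+s. h s \<partial>(lborel \<Otimes>\<^sub>M lborel \<Otimes>\<^sub>M lborel)) =
    (\<integral>\<^sup>+x. \<integral>\<^sup>+y. \<integral>\<^sup>+z. h (x, y, z) \<partial>lborel \<partial>lborel \<partial>lborel)"
proof -
  show ?thesis
    by (simp add: lborel_pair.nn_integral_fst[symmetric] lborel.nn_integral_fst[symmetric])
qed

text \<open>Since \<open>h\<close> vanishes off the cube, each one-dimensional substitution can run
  over the whole real line; for parameters where it would degenerate, both integrals are
  zero.\<close>

lemma nn_integral_T:
  fixes h :: "real \<times> real \<times> real \<Rightarrow> ennreal"
  assumes h [measurable]: "h \<in> borel_measurable (borel \<Otimes>\<^sub>M borel \<Otimes>\<^sub>M borel)"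
    and zero: "\<And>s. s \<notin> cube \<Longrightarrow> h s = 0"
  shows "(\<integral>\<^sup>+s. h s \<partial>(lborel \<Otimes>\<^sub>M lborel \<Otimes>\<^sub>M lborel)) =
    (\<integral>\<^sup>+s. h (T s) * ennreal (J s) * indicator cube s \<partial>(lborel \<Otimes>\<^sub>M lborel \<Otimes>\<^sub>M lborel))"
proof -
  \<comment> \<open>\<open>h1\<close>, \<open>h2\<close>, \<open>h3\<close> are the integrands in the coordinates \<open>(y1, y2, T1)\<close>, \<open>(y1, T2, T1)\<close>
    and \<open>(T3, T2, T1)\<close>, each including the factor of the substitution that leads to it.\<close>
  define h1 where "h1 x y u = h (x, y, (u - y) / ((1 - x) * (1 - y))) * ennreal (1 / ((1 - x) * (1 - y)))"
    for x y u
  define h2 where "h2 x v u = h1 x (u * v / x) u * ennreal (u / x)" for x v u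
  define h3 where "h3 w v u = h2 (v + (1 - u) * (1 - v) * w) v u * ennreal ((1 - u) * (1 - v))" for w v u
  have [measurable]: "cube \<in> sets (borel \<Otimes>\<^sub>M borel \<Otimes>\<^sub>M borel)"
    unfolding cube_def by measurable
  have [measurable]: "J \<in> borel_measurable (borel \<Otimes>\<^sub>M borel \<Otimes>\<^sub>M borel)"
    unfolding J_def E_def G_def by measurable
  have [measurable (raw)]: "(\<lambda>t. h1 (a t) (b t) (c t)) \<in> borel_measurable N"
    if [measurable]: "a \<in> borel_measurable N" "b \<in> borel_measurable N" "c \<in> borel_measurable N"
    for a b c and N :: "'n measure"
    unfolding h1_def by measurable
  have [measurable (raw)]: "(\<lambda>t. h2 (a t) (b t) (c t)) \<in> borel_measurable N"
    if [measurable]: "a \<in> borel_measurable N" "b \<in> borel_measurable N" "c \<in> borel_measurable N"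
    for a b c and N :: "'n measure"
    unfolding h2_def by measurable
  \<comment> \<open>The supports of \<open>h1\<close> and \<open>h2\<close> come from points of the
    cube. This settles the degenerate cases of \<open>s2\<close> and \<open>s3\<close> and the
    off-cube case of \<open>h3_eq\<close>.\<close>
  have h1_cube: "\<exists>z. (x, y, z) \<in> cube \<and> u = T1 x y z" if "h1 x y u \<noteq> 0" for x y u
  proof -
    have *: "(x, y, (u - y) / ((1 - x) * (1 - y))) \<in> cube"
      using that zero[of "(x, y, (u - y) / ((1 - x) * (1 - y)))"] by (auto simp: h1_def)
    then have "u = T1 x y ((u - y) / ((1 - x) * (1 - y)))"
      by (auto simp: T1_def mem_cube)
    with * show ?thesis by blast
  qed
  have h2_cube: "\<exists>y z. (x, y, z) \<in> cube \<and> u = T1 x y z \<and> v = T2 x y z" if nz: "h2 x v u \<noteq> 0" for x v u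
  proof -
    from nz have "h1 x (u * v / x) u \<noteq> 0" by (auto simp: h2_def)
    from h1_cube[OF this] obtain z where z: "(x, u * v / x, z) \<in> cube" "u = T1 x (u * v / x) z" by blast
    then have "x > 0" "u > 0"
      using T1_pos[of x "u * v / x" z] by (simp_all add: mem_cube)
    then have "v = T2 x (u * v / x) z" unfolding T2_def z(2)[symmetric] by simp
    with z show ?thesis by blast
  qed
  have h3_eq: "h3 w v u = h (T (u, v, w)) * ennreal (J (u, v, w)) * indicator cube (u, v, w)" for w v u
  proof (cases "(u, v, w) \<in> cube")
    case True
    then have uvw: "0 < u" "u < 1" "0 < v" "v < 1" "0 < w" "w < 1" by (auto simp: mem_cube)
    define x y where "x = T1 u v w" and "y = T2 u v w"
    have pos: "0 < E u w" "0 < G v w" "0 < x" "x < 1" "0 < y" "y < 1"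
      using uvw by (auto simp: x_def y_def E_pos G_pos T1_pos T2_pos T_less_1)
    have ux: "1 - x = (1 - v) * E u w" "1 - y = (1 - u) * G v w / x" "y = u * v / x"
      using one_minus_T1[OF uvw] one_minus_T2[OF uvw] by (simp_all add: x_def y_def T2_def[of u])
    \<comment> \<open>The involution at \<open>(u, v, w)\<close>; solving this affine equation for
      the last argument identifies the third coordinate at which \<open>h1\<close> evaluates
      \<open>h\<close>.\<close>
    have "u = T1 x y (T3 u v w)"
      using uvw by (simp add: x_def y_def T1_T)
    then have "u - y = (1 - x) * (1 - y) * T3 u v w"
      unfolding T1_def by linarith
    then have z: "(u - y) / ((1 - x) * (1 - y)) = T3 u v w"
      using pos by simp
    have "h3 w v u = h (x, y, T3 u v w) * (ennreal (1 / ((1 - x) * (1 - y))) * ennreal (u / x) * ennreal ((1 - u) * (1 - v)))"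
      unfolding h3_def h2_def h1_def T1_def[symmetric] x_def[symmetric] ux(3)[symmetric] z
      by (simp add: mult.assoc)
    also have "ennreal (1 / ((1 - x) * (1 - y))) * ennreal (u / x) * ennreal ((1 - u) * (1 - v)) =
        ennreal (1 / ((1 - x) * (1 - y)) * (u / x) * ((1 - u) * (1 - v)))"
      using uvw pos by (simp add: ennreal_mult'[symmetric])
    also have "1 / ((1 - x) * (1 - y)) * (u / x) * ((1 - u) * (1 - v)) = J (u, v, w)"
    proof -
      \<comment> \<open>The variables \<open>a\<close> and \<open>b\<close> stand for
        \<open>1 - u\<close> and \<open>1 - v\<close>, so that these differences stay atomic while
        denominators are cleared.\<close>
      have "1 / (b * E u w * (a * G v w / x)) * (u / x) * (a * b) = u / (E u w * G v w)"
        if "a > 0" "b > 0" for a b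
        using that pos by (simp add: field_simps)
      from this[of "1 - u" "1 - v"] show ?thesis using uvw by (simp add: ux(1,2) J_def)
    qed
    finally show ?thesis using True by (simp add: T_def x_def y_def)
  next
    case False
    have "h3 w v u = 0"
    proof (rule ccontr)
      \<comment> \<open>A nonzero value makes \<open>(u, v)\<close> the first two components of the
        image of a cube point with first coordinate \<open>T1 u v w\<close>. By the involution, the
        third component \<open>?w\<close> satisfies \<open>T1 u v ?w = T1 u v w\<close>. As
        \<open>T1 u v\<close> is affine with nonzero slope, \<open>?w = w\<close>, which puts
        \<open>(u, v, w)\<close> in the cube.\<close>
      assume nz: "h3 w v u \<noteq> 0"
      then have "h2 (v + (1 - u) * (1 - v) * w) v u \<noteq> 0" by (auto simp: h3_def)
      from h2_cube[OF this] obtain y z where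
        c: "(T1 u v w, y, z) \<in> cube" and u: "u = T1 (T1 u v w) y z" and v: "v = T2 (T1 u v w) y z"
        unfolding T1_def[of u v w] by blast
      let ?w = "T3 (T1 u v w) y z"
      have c': "(u, v, ?w) \<in> cube" using T_in_cube[OF c] u v by (simp add: T_def)
      have "T1 u v ?w = T1 u v w"
        using c T1_T[of "T1 u v w" y z] u v by (simp add: mem_cube)
      with c' have "?w = w" by (simp add: T1_def mem_cube)
      with c' False show False by simp
    qed
    with False show ?thesis by simp
  qed
  have s1: "(\<integral>\<^sup>+z. h (x, y, z) \<partial>lborel) = (\<integral>\<^sup>+u. h1 x y u \<partial>lborel)" for x y
  proof (cases "0 < x \<and> x < 1 \<and> 0 < y \<and> y < 1")
    case True
    let ?c = "(1 - x) * (1 - y)"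
    \<comment> \<open>The substitution is applied to the right-hand integral, returning from
      \<open>u\<close> to \<open>z\<close>; its factor \<open>?c\<close> cancels the
      \<open>1 / ?c\<close> built into \<open>h1\<close>.\<close>
    have "(\<integral>\<^sup>+u. h1 x y u \<partial>lborel) = ennreal \<bar>?c\<bar> * (\<integral>\<^sup>+z. h1 x y (y + ?c * z) \<partial>lborel)"
      using True by (intro nn_integral_real_affine) auto
    also have "\<dots> = (\<integral>\<^sup>+z. ennreal ?c * h1 x y (y + ?c * z) \<partial>lborel)"
      using True by (subst nn_integral_cmult) (auto simp: abs_mult)
    also have "\<dots> = (\<integral>\<^sup>+z. h (x, y, z) \<partial>lborel)"
    proof (intro nn_integral_cong)
      fix z
      have "ennreal ?c * ennreal (1 / ?c) = 1"
        using True by (subst ennreal_mult'[symmetric]) auto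
      then have "ennreal ?c * (h (x, y, z) * ennreal (1 / ?c)) = h (x, y, z)"
        by (metis mult.left_commute mult.right_neutral)
      then show "ennreal ?c * h1 x y (y + ?c * z) = h (x, y, z)"
        unfolding h1_def using True by simp
    qed
    finally show ?thesis by simp
  next
    case False
    then have "h (x, y, z) = 0" for z by (intro zero) (auto simp: mem_cube)
    with False show ?thesis by (simp add: h1_def)
  qed
  have s2: "(\<integral>\<^sup>+y. h1 x y u \<partial>lborel) = (\<integral>\<^sup>+v. h2 x v u \<partial>lborel)" for x u
  proof (cases "0 < x \<and> 0 < u")
    case True
    have "(\<integral>\<^sup>+y. h1 x y u \<partial>lborel) = ennreal \<bar>u / x\<bar> * (\<integral>\<^sup>+v. h1 x (0 + u / x * v) u \<partial>lborel)"
      using True by (intro nn_integral_real_affine) auto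
    also have "\<dots> = (\<integral>\<^sup>+v. h2 x v u \<partial>lborel)"
      using True by (subst nn_integral_cmult[symmetric]) (auto simp: h2_def mult.commute)
    finally show ?thesis .
  next
    case False
    then have "h1 x y u = 0" for y
      using h1_cube[of x y u] T1_pos[of x y] unfolding mem_cube by blast
    then show ?thesis by (simp add: h2_def)
  qed
  have s3: "(\<integral>\<^sup>+x. h2 x v u \<partial>lborel) = (\<integral>\<^sup>+w. h3 w v u \<partial>lborel)" for v u
  proof (cases "u < 1 \<and> v < 1")
    case True
    let ?c = "(1 - u) * (1 - v)"
    have "(\<integral>\<^sup>+x. h2 x v u \<partial>lborel) = ennreal \<bar>?c\<bar> * (\<integral>\<^sup>+w. h2 (v + ?c * w) v u \<partial>lborel)"
      using True by (intro nn_integral_real_affine) auto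
    also have "\<dots> = (\<integral>\<^sup>+w. h3 w v u \<partial>lborel)"
      using True by (subst nn_integral_cmult[symmetric]) (auto simp: h3_def mult.commute abs_mult)
    finally show ?thesis .
  next
    case False
    then have "h2 x v u = 0" for x
      using h2_cube[of x v u] T_less_1(1,2)[of x] unfolding mem_cube by blast
    then show ?thesis by (simp add: h3_def)
  qed
  have "(\<integral>\<^sup>+s. h s \<partial>(lborel \<Otimes>\<^sub>M lborel \<Otimes>\<^sub>M lborel)) =
      (\<integral>\<^sup>+x. \<integral>\<^sup>+y. \<integral>\<^sup>+u. h1 x y u \<partial>lborel \<partial>lborel \<partial>lborel)"
    by (simp add: nn_integral_lborel_triple s1)
  \<comment> \<open>Tonelli swaps between the substitutions bring the coordinate to be replaced next
    into the innermost integral.\<close>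
  also have "\<dots> = (\<integral>\<^sup>+x. \<integral>\<^sup>+u. \<integral>\<^sup>+y. h1 x y u \<partial>lborel \<partial>lborel \<partial>lborel)"
    by (intro nn_integral_cong lborel_pair.Fubini') simp
  also have "\<dots> = (\<integral>\<^sup>+x. \<integral>\<^sup>+u. \<integral>\<^sup>+v. h2 x v u \<partial>lborel \<partial>lborel \<partial>lborel)"
    by (simp add: s2)
  also have "\<dots> = (\<integral>\<^sup>+u. \<integral>\<^sup>+x. \<integral>\<^sup>+v. h2 x v u \<partial>lborel \<partial>lborel \<partial>lborel)"
    by (intro lborel_pair.Fubini') simp
  also have "\<dots> = (\<integral>\<^sup>+u. \<integral>\<^sup>+v. \<integral>\<^sup>+x. h2 x v u \<partial>lborel \<partial>lborel \<partial>lborel)"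
    by (intro nn_integral_cong lborel_pair.Fubini') simp
  also have "\<dots> = (\<integral>\<^sup>+u. \<integral>\<^sup>+v. \<integral>\<^sup>+w. h3 w v u \<partial>lborel \<partial>lborel \<partial>lborel)"
    by (simp add: s3)
  also have "\<dots> = (\<integral>\<^sup>+s. h (T s) * ennreal (J s) * indicator cube s \<partial>(lborel \<Otimes>\<^sub>M lborel \<Otimes>\<^sub>M lborel))"
    by (subst nn_integral_lborel_triple) (simp_all add: h3_eq)
  finally show ?thesis .
qed

section \<open>The joint density of the beta laws and its transformation\<close>

lemma beta_density_nonneg: "a > 0 \<Longrightarrow> b > 0 \<Longrightarrow> beta_density a b x \<ge> 0"
  by (simp add: beta_density_def Beta_def Gamma_real_pos less_imp_le)

lemma measurable_beta_density [measurable]: "beta_density a b \<in> borel_measurable borel"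
  unfolding beta_density_def by measurable

lemma sigma_finite_beta_distribution: "sigma_finite_measure (beta_distribution a b)"
  unfolding beta_distribution_def by (subst sigma_finite_measure.sigma_finite_iff_density_finite[OF sigma_finite_lborel]) auto

definition triple_density :: "real \<Rightarrow> real \<Rightarrow> real \<Rightarrow> real \<times> real \<times> real \<Rightarrow> real" where
  "triple_density p q r = (\<lambda>(x, y, z).
     beta_density (p + r) (q + r) x * (beta_density p (q + r) y * beta_density r q z))"

lemma measurable_triple_density [measurable]:
  "triple_density p q r \<in> borel_measurable (borel \<Otimes>\<^sub>M borel \<Otimes>\<^sub>M borel)"
  unfolding triple_density_def by measurable

lemma triple_density_zero: "s \<notin> cube \<Longrightarrow> triple_density p q r s = 0"
  by (cases s) (auto simp: triple_density_def beta_density_def mem_cube)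

lemma beta_triple_eq_density:
  assumes "p > 0" "q > 0" "r > 0"
  shows "beta_distribution (p + r) (q + r) \<Otimes>\<^sub>M beta_distribution p (q + r) \<Otimes>\<^sub>M beta_distribution r q =
    density (lborel \<Otimes>\<^sub>M lborel \<Otimes>\<^sub>M lborel) (\<lambda>s. ennreal (triple_density p q r s))"
proof -
  \<comment> \<open>Supplies sigma-finiteness of the inner product measure, required when the
    product density rule is applied a second time.\<close>
  interpret B: pair_sigma_finite "beta_distribution p (q + r)" "beta_distribution r q"
    using sigma_finite_beta_distribution by (rule pair_sigma_finite.intro) (rule sigma_finite_beta_distribution)
  have eq: "beta_distribution p (q + r) \<Otimes>\<^sub>M beta_distribution r q =
    density (lborel \<Otimes>\<^sub>M lborel) (\<lambda>(y, z). ennreal (beta_density p (q + r) y) * ennreal (beta_density r q z))"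
    unfolding beta_distribution_def
    by (rule pair_measure_density)
       (auto intro: lborel.sigma_finite_measure_axioms sigma_finite_beta_distribution[unfolded beta_distribution_def])
  have "beta_distribution (p + r) (q + r) \<Otimes>\<^sub>M beta_distribution p (q + r) \<Otimes>\<^sub>M beta_distribution r q =
    density (lborel \<Otimes>\<^sub>M lborel \<Otimes>\<^sub>M lborel) (\<lambda>(x, s). ennreal (beta_density (p + r) (q + r) x) *
      (case s of (y, z) \<Rightarrow> ennreal (beta_density p (q + r) y) * ennreal (beta_density r q z)))"
    unfolding eq unfolding beta_distribution_def[of "p + r"]
    by (rule pair_measure_density)
       (auto intro: lborel_pair.sigma_finite_measure_axioms B.sigma_finite_measure_axioms simp flip: eq)
  also have "\<dots> = density (lborel \<Otimes>\<^sub>M lborel \<Otimes>\<^sub>M lborel) (\<lambda>s. ennreal (triple_density p q r s))"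
    using assms by (intro arg_cong[where f = "density _"] ext)
      (auto simp: triple_density_def ennreal_mult beta_density_nonneg split: prod.splits)
  finally show ?thesis .
qed

text \<open>A count of exponents: \<open>t\<close> gets
  \<open>(p + r - 1) - (p - 1) - (q + r - 1) + (q - 1) = 0\<close>; \<open>e\<close> and
  \<open>g\<close> each get \<open>(q + r - 1) - (r - 1) - (q - 1) - 1 = 0\<close>, the last
  \<open>-1\<close> coming from \<open>J\<close>; and \<open>x\<close> gets
  \<open>(p - 1) + (r - 1) + 1 = p + r - 1\<close>. The Beta constants agree on both sides.\<close>

lemma triple_density_T:
  assumes "s \<in> cube"
  shows "triple_density p q r (T s) * J s = triple_density p q r s"
proof -
  obtain x y z where s: "s = (x, y, z)" by (cases s)
  have xyz: "0 < x" "x < 1" "0 < y" "y < 1" "0 < z" "z < 1" using assms by (auto simp: s mem_cube)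
  note pos = E_pos[OF xyz] G_pos[OF xyz] T1_pos[OF xyz]
  define e g t where "e = E x z" and "g = G y z" and "t = T1 x y z"
  have p: "e > 0" "g > 0" "t > 0" using pos by (auto simp: e_def g_def t_def)
  have densities: "t powr (p + r - 1) * ((1 - y) * e) powr (q + r - 1) *
      ((x * y / t) powr (p - 1) * ((1 - x) * g / t) powr (q + r - 1) *
       ((x * z / (e * g)) powr (r - 1) * ((1 - z) * t / (e * g)) powr (q - 1))) * (x / (e * g)) =
     x powr (p + r - 1) * (1 - x) powr (q + r - 1) *
      (y powr (p - 1) * (1 - y) powr (q + r - 1) * (z powr (r - 1) * (1 - z) powr (q - 1)))"
    (is "?L = ?R")
  proof -
    \<comment> \<open>Logarithms turn the identity of products of powers into a linear one in the
      logarithms of the factors; \<open>ln\<close> is injective on positive reals.\<close>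
    have "ln ?L = ln ?R"
      using xyz p by (simp add: ln_mult ln_div ln_powr) (simp add: algebra_simps)
    moreover have "?L > 0" "?R > 0" using xyz p by simp_all
    ultimately show ?thesis by simp
  qed
  have one_minus: "1 - t = (1 - y) * e" "1 - x * y / t = (1 - x) * g / t"
      "1 - x * z / (e * g) = (1 - z) * t / (e * g)"
    using one_minus_T1[OF xyz] one_minus_T2[OF xyz] one_minus_T3[OF xyz]
    by (simp_all add: T2_def T3_def e_def g_def t_def)
  have "T s = (t, x * y / t, x * z / (e * g))"
    by (simp add: s T_def T2_def T3_def e_def g_def t_def)
  moreover have "0 < t" "t < 1" "0 < x * y / t" "x * y / t < 1"
      "0 < x * z / (e * g)" "x * z / (e * g) < 1"
    using T1_pos[OF xyz] T2_pos[OF xyz] T3_pos[OF xyz] T_less_1[OF xyz]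
    by (simp_all only: T2_def T3_def e_def g_def t_def)
  moreover have "J s = x / (e * g)"
    by (simp add: J_def s e_def g_def)
  ultimately have "triple_density p q r (T s) * J s =
      ?L / (Beta (p + r) (q + r) * Beta p (q + r) * Beta r q)"
    by (simp add: triple_density_def beta_density_def flip: one_minus)
  moreover have "triple_density p q r s = ?R / (Beta (p + r) (q + r) * Beta p (q + r) * Beta r q)"
    using xyz by (simp add: triple_density_def s beta_density_def)
  ultimately show ?thesis by (simp only: densities)
qed

section \<open>Invariance of the joint law under the map\<close>

theorem theorem1:
  fixes p q r :: real
    and M :: "'a measure"
    and Y1 Y2 Y3 :: "'a \<Rightarrow> real"
  assumes "p > 0" and "q > 0" and "r > 0"
    and "prob_space M"
    and "Y1 \<in> borel_measurable M" and "Y2 \<in> borel_measurable M" and "Y3 \<in> borel_measurable M"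
    and "distr M (borel \<Otimes>\<^sub>M borel \<Otimes>\<^sub>M borel) (\<lambda>\<omega>. (Y1 \<omega>, Y2 \<omega>, Y3 \<omega>)) =
           beta_distribution (p + r) (q + r) \<Otimes>\<^sub>M beta_distribution p (q + r) \<Otimes>\<^sub>M beta_distribution r q"
  shows "distr M (borel \<Otimes>\<^sub>M borel \<Otimes>\<^sub>M borel)
           (\<lambda>\<omega>. (Y2 \<omega> + (1 - Y1 \<omega>) * (1 - Y2 \<omega>) * Y3 \<omega>,
                 (Y1 \<omega> * Y2 \<omega>) / (Y2 \<omega> + (1 - Y1 \<omega>) * (1 - Y2 \<omega>) * Y3 \<omega>),
                 (Y1 \<omega> * Y3 \<omega>) /
                   ((1 - (1 - Y1 \<omega>) * Y3 \<omega>) * (Y2 \<omega> + Y3 \<omega> * (1 - Y2 \<omega>))))) =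
         distr M (borel \<Otimes>\<^sub>M borel \<Otimes>\<^sub>M borel) (\<lambda>\<omega>. (Y1 \<omega>, Y2 \<omega>, Y3 \<omega>))"
proof -
  note [measurable] = assms(5-7)
  let ?B = "borel \<Otimes>\<^sub>M borel \<Otimes>\<^sub>M borel :: (real \<times> real \<times> real) measure"
  let ?L = "lborel \<Otimes>\<^sub>M lborel \<Otimes>\<^sub>M lborel :: (real \<times> real \<times> real) measure"
  let ?Y = "\<lambda>\<omega>. (Y1 \<omega>, Y2 \<omega>, Y3 \<omega>)"
  let ?f = "triple_density p q r"
  let ?D = "density ?L (\<lambda>s. ennreal (?f s))"
  have law: "distr M ?B ?Y = ?D"
    using assms(1-3,8) by (simp add: beta_triple_eq_density)
  have sets_L: "sets ?L = sets ?B"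
    by (intro sets_pair_measure_cong) simp_all
  have [measurable_cong]: "sets ?D = sets ?B" by (simp add: sets_L)
  have "distr ?D ?B T = ?D"
  proof (rule measure_eqI)
    show "sets (distr ?D ?B T) = sets ?D" by (simp add: sets_L)
    fix A assume "A \<in> sets (distr ?D ?B T)"
    then have A [measurable]: "A \<in> sets ?B" by simp
    have "emeasure (distr ?D ?B T) A = (\<integral>\<^sup>+s. indicator A s \<partial>distr ?D ?B T)" by simp
    also have "\<dots> = (\<integral>\<^sup>+s. indicator A (T s) \<partial>?D)"
      by (intro nn_integral_distr) measurable
    also have "\<dots> = (\<integral>\<^sup>+s. ennreal (?f s) * indicator A (T s) \<partial>?L)"
      by (intro nn_integral_density) measurable
    \<comment> \<open>The change of variables is applied to
      \<open>ennreal (?f s) * indicator A (T s)\<close>, so the indicator is evaluated at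
      \<open>T (T s)\<close>, which is \<open>s\<close> on the cube.\<close>
    also have "\<dots> = (\<integral>\<^sup>+s. ennreal (?f (T s)) * indicator A (T (T s)) * ennreal (J s) * indicator cube s \<partial>?L)"
      by (intro nn_integral_T) (simp_all add: triple_density_zero)
    also have "\<dots> = (\<integral>\<^sup>+s. ennreal (?f s) * indicator A s \<partial>?L)"
    proof (intro nn_integral_cong)
      fix s :: "real \<times> real \<times> real"
      show "ennreal (?f (T s)) * indicator A (T (T s)) * ennreal (J s) * indicator cube s =
          ennreal (?f s) * indicator A s"
      proof (cases "s \<in> cube")
        case True
        then have "J s \<ge> 0"
          by (cases s) (auto simp: J_def mem_cube E_pos G_pos less_imp_le)
        then have "ennreal (?f (T s)) * ennreal (J s) = ennreal (?f s)"
          using triple_density_T[OF True] by (simp flip: ennreal_mult'')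
        with True show ?thesis by (simp add: T_involution ac_simps) (metis mult.assoc mult.commute)
      next
        case False
        then show ?thesis by (simp add: triple_density_zero)
      qed
    qed
    also have "\<dots> = emeasure ?D A"
      by (intro emeasure_density[symmetric]) measurable
    finally show "emeasure (distr ?D ?B T) A = emeasure ?D A" .
  qed
  \<comment> \<open>The vector in the claim is \<open>T\<close> composed with \<open>?Y\<close>, so
    its law is the image under \<open>T\<close> of the law of \<open>?Y\<close>.\<close>
  then have "distr (distr M ?B ?Y) ?B T = distr M ?B ?Y" by (simp add: law)
  then show ?thesis
    by (subst (asm) distr_distr) (simp_all add: comp_def T_def T1_def T2_def T3_def E_def G_def)
qed

end
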